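(* Let $m\ge1$ and let $K,L$ be positive semidefinite Hermitian $m\times m$ complex matrices with $\mathrm{tr}(K+L)=1$. Define the $2m\times2m$ matrices $$Y=\begin{pmatrix}K^{1/2}\\L^{1/2}\end{pmatrix}\ (2m\times m),\qquad\sigma_0=YY^*,\qquad J=\begin{pmatrix}I_m&0\\0&-I_m\end{pmatrix},\qquad\sigma_1=J\sigma_0J.$$ Then $(\sigma_0,\sigma_1)$ is a binary-input output-symmetric classical--quantum channel. Its uniform-prior Holevo information and its pretty-good-measurement bit error are $$\chi(\sigma_0,\sigma_1)=\mathsf S(K)+\mathsf S(L)-\mathsf S(K+L),\qquad p_{\mathrm e}(\sigma_0,\sigma_1)=\frac{1-2\,\mathrm{tr}(K^{1/2}L^{1/2})}2 .$$
   Context: For a positive semidefinite matrix $M$ with trace at most one, $\mathsf S(M)=-\mathrm{tr}(M\log_2M)$ (with $0\log_20=0$). A binary-input classical--quantum channel is a pair of density matrices $(\sigma_0,\sigma_1)$ (positive semidefinite, trace one); it is output-symmetric if there is a unitary $U$ with $U\sigma_0U^*=\sigma_1$ and $U\sigma_1U^*=\sigma_0$. With $\overline\sigma=(\sigma_0+\sigma_1)/2$, the uniform-prior Holevo information is $\chi=\mathsf S(\overline\sigma)-\frac12\mathsf S(\sigma_0)-\frac12\mathsf S(\sigma_1)$. The pretty good measurement (PGM) for the uniform prior has elements $M_b=\frac12\overline\sigma^{-1/2}\sigma_b\overline\sigma^{-1/2}$ ($b=0,1$; inverse square root taken on the support of $\overline\sigma$), and its bit error for a symmetric channel is $p_{\mathrm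 e}=\mathrm{tr}(\sigma_0M_1)=\frac12\mathrm{tr}(\sigma_0\overline\sigma^{-1/2}\sigma_1\overline\sigma^{-1/2})$. *)

theory Defs
  imports Complex_Main "Jordan_Normal_Form.Schur_Decomposition"
begin

definition mat_trace :: "complex mat \<Rightarrow> complex" where
  "mat_trace A = (\<Sum>i<dim_row A. A $$ (i, i))"

definition is_unitary :: "nat \<Rightarrow> complex mat \<Rightarrow> bool" where
  "is_unitary n U \<longleftrightarrow> U \<in> carrier_mat n n \<and>
     U * mat_adjoint U = 1\<^sub>m n \<and> mat_adjoint U * U = 1\<^sub>m n"

definition is_psd :: "nat \<Rightarrow> complex mat \<Rightarrow> bool" where
  "is_psd n A \<longleftrightarrow> A \<in> carrier_mat n n \<and> mat_adjoint A = A \<and>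
     (\<forall>v \<in> carrier_vec n. 0 \<le> Re ((A *\<^sub>v v) \<bullet>c v))"

text \<open>Functional calculus for Hermitian matrices: if \<open>A = U diag(d) U*\<close> with \<open>U\<close> unitary and
  \<open>d\<close> real, then \<open>spec_fun f A = U diag(f d) U*\<close>. By the spectral theorem such a decomposition
  exists for every Hermitian \<open>A\<close>, and the result does not depend on the chosen one.\<close>

definition spec_fun :: "(real \<Rightarrow> real) \<Rightarrow> complex mat \<Rightarrow> complex mat" where
  "spec_fun f A = (THE B. \<exists>U d. is_unitary (dim_row A) U \<and>
     A = U * mat_diag (dim_row A) (\<lambda>i. complex_of_real (d i)) * mat_adjoint U \<and>
     B = U * mat_diag (dim_row A) (\<lambda>i. complex_of_real (f (d i))) * mat_adjoint U)"

definition mat_sqrt :: "complex mat \<Rightarrow> complex mat" where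
  "mat_sqrt = spec_fun sqrt"

text \<open>The inverse square root is taken on the support, and is zero on the kernel.\<close>

definition mat_inv_sqrt :: "complex mat \<Rightarrow> complex mat" where
  "mat_inv_sqrt = spec_fun (\<lambda>x. if x = 0 then 0 else 1 / sqrt x)"

text \<open>Entropy, Holevo information and bit error are kept complex-valued, as traces, so that no
  imaginary part is discarded.\<close>

definition entropy :: "complex mat \<Rightarrow> complex" where
  "entropy M = - mat_trace (spec_fun (\<lambda>x. if x = 0 then 0 else x * log 2 x) M)"

definition is_density :: "nat \<Rightarrow> complex mat \<Rightarrow> bool" where
  "is_density n \<sigma> \<longleftrightarrow> is_psd n \<sigma> \<and> mat_trace \<sigma> = 1"

definition cq_channel :: "nat \<Rightarrow> complex mat \<Rightarrow> complex mat \<Rightarrow> bool" where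
  "cq_channel n \<sigma>0 \<sigma>1 \<longleftrightarrow> is_density n \<sigma>0 \<and> is_density n \<sigma>1"

definition output_symmetric :: "nat \<Rightarrow> complex mat \<Rightarrow> complex mat \<Rightarrow> bool" where
  "output_symmetric n \<sigma>0 \<sigma>1 \<longleftrightarrow> (\<exists>U. is_unitary n U \<and>
     U * \<sigma>0 * mat_adjoint U = \<sigma>1 \<and> U * \<sigma>1 * mat_adjoint U = \<sigma>0)"

definition avg_state :: "complex mat \<Rightarrow> complex mat \<Rightarrow> complex mat" where
  "avg_state \<sigma>0 \<sigma>1 = (1 / 2) \<cdot>\<^sub>m (\<sigma>0 + \<sigma>1)"

definition holevo :: "complex mat \<Rightarrow> complex mat \<Rightarrow> complex" where
  "holevo \<sigma>0 \<sigma>1 = entropy (avg_state \<sigma>0 \<sigma>1) - (1 / 2) * entropy \<sigma>0 - (1 / 2) * entropy \<sigma>1"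

text \<open>The outcome \<open>b\<close> is encoded as a truth value: \<open>False\<close> for 0 and \<open>True\<close> for 1.\<close>

definition pgm_elem :: "complex mat \<Rightarrow> complex mat \<Rightarrow> bool \<Rightarrow> complex mat" where
  "pgm_elem \<sigma>0 \<sigma>1 b = (1 / 2) \<cdot>\<^sub>m
     (mat_inv_sqrt (avg_state \<sigma>0 \<sigma>1) * (if b then \<sigma>1 else \<sigma>0) * mat_inv_sqrt (avg_state \<sigma>0 \<sigma>1))"

text \<open>This is the probability of error given input 0; for an output-symmetric channel it is
  also the one given input 1.\<close>

definition pgm_bit_error :: "complex mat \<Rightarrow> complex mat \<Rightarrow> complex" where
  "pgm_bit_error \<sigma>0 \<sigma>1 = mat_trace (\<sigma>0 * pgm_elem \<sigma>0 \<sigma>1 True)"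

end

theory Submission
  imports Defs "Jordan_Normal_Form.Spectral_Radius"
begin

text \<open>If \<open>A X = X B\<close> for Hermitian \<open>A\<close> and \<open>B\<close>, then \<open>f A X = X f B\<close> for every function \<open>f\<close>.
  With \<open>X = 1\<close> this makes the functional calculus well defined; with \<open>A = Y Y*\<close>, \<open>X = Y\<close>, \<open>B = Y* Y\<close>
  it shows that \<open>\<sigma>\<^sub>0\<close> and \<open>\<sigma>\<^sub>1\<close> have the entropy of \<open>Y* Y = K + L\<close>. The average state is the block
  diagonal matrix of \<open>K\<close> and \<open>L\<close>, whence the Holevo information. If \<open>R\<close> is its inverse square root,
  then \<open>Y* R J Y = sqrt K - sqrt L\<close>, and the bit error is half the trace of the square of this matrix.\<close>

section \<open>Adjoint, trace and block matrices\<close>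

text \<open>Side conditions as equations between dimensions, instead of carrier sets, leave no
  intermediate sizes to be guessed when long products are rebracketed to the right.\<close>

lemma mult_mat_assoc_dim:
  fixes A B C :: "complex mat"
  assumes "dim_col A = dim_row B" "dim_col B = dim_row C"
  shows "A * B * C = A * (B * C)"
  by (rule assoc_mult_mat) (use assms in \<open>auto intro!: carrier_matI\<close>)

lemma mat_adjoint_dim [simp]:
  "dim_row (mat_adjoint A) = dim_col A" "dim_col (mat_adjoint A) = dim_row A"
  by (auto simp: mat_adjoint_def)

lemma mat_adjoint_carrier:
  "A \<in> carrier_mat n k \<Longrightarrow> mat_adjoint A \<in> carrier_mat k n"
  by (auto intro!: carrier_matI)

lemma mat_adjoint_index [simp]:
  fixes A :: "complex mat"
  assumes "i < dim_col A" "j < dim_row A"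
  shows "mat_adjoint A $$ (i, j) = cnj (A $$ (j, i))"
  using assms by (simp add: mat_adjoint_def mat_of_rows_index)

lemma mat_adjoint_adjoint [simp]:
  fixes A :: "complex mat"
  shows "mat_adjoint (mat_adjoint A) = A"
  by (rule eq_matI) auto

lemma mat_adjoint_mult:
  fixes A B :: "complex mat"
  assumes "dim_col A = dim_row B"
  shows "mat_adjoint (A * B) = mat_adjoint B * mat_adjoint A"
  by (rule eq_matI) (use assms in \<open>auto simp: scalar_prod_def intro!: sum.cong\<close>)

lemma mat_adjoint_one [simp]: "mat_adjoint (1\<^sub>m n :: complex mat) = 1\<^sub>m n"
  by (rule eq_matI) auto

lemma mat_adjoint_zero [simp]: "mat_adjoint (0\<^sub>m n k :: complex mat) = 0\<^sub>m k n"
  by (rule eq_matI) auto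

lemma mat_adjoint_uminus: "mat_adjoint (- A :: complex mat) = - mat_adjoint A"
  by (rule eq_matI) auto

lemma mat_adjoint_four_block:
  fixes A B C D :: "complex mat"
  assumes "A \<in> carrier_mat r1 c1" "B \<in> carrier_mat r1 c2"
    "C \<in> carrier_mat r2 c1" "D \<in> carrier_mat r2 c2"
  shows "mat_adjoint (four_block_mat A B C D) =
    four_block_mat (mat_adjoint A) (mat_adjoint C) (mat_adjoint B) (mat_adjoint D)"
  by (rule eq_matI) (use assms in auto)

lemma cscalar_prod_adjoint:
  fixes A :: "complex mat"
  assumes "A \<in> carrier_mat n k" "v \<in> carrier_vec k" "w \<in> carrier_vec n"
  shows "(A *\<^sub>v v) \<bullet>c w = v \<bullet>c (mat_adjoint A *\<^sub>v w)"
proof -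
  have "(A *\<^sub>v v) \<bullet>c w = (\<Sum>i<n. \<Sum>j<k. A $$ (i, j) * v $ j * cnj (w $ i))"
    using assms by (auto simp: scalar_prod_def sum_distrib_right atLeast0LessThan intro!: sum.cong)
  also have "\<dots> = (\<Sum>j<k. \<Sum>i<n. A $$ (i, j) * v $ j * cnj (w $ i))"
    by (rule sum.swap)
  also have "\<dots> = v \<bullet>c (mat_adjoint A *\<^sub>v w)"
    using assms by (auto simp: scalar_prod_def sum_distrib_left atLeast0LessThan mult_ac intro!: sum.cong)
  finally show ?thesis .
qed

lemma cscalar_prod_self:
  fixes v :: "complex vec"
  shows "v \<bullet>c v = complex_of_real (\<Sum>i<dim_vec v. (cmod (v $ i))\<^sup>2)"
  by (auto simp: scalar_prod_def complex_norm_square atLeast0LessThan simp del: of_real_power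
      intro!: sum.cong)

lemma mat_trace_mult_commute:
  assumes "A \<in> carrier_mat n k" "B \<in> carrier_mat k n"
  shows "mat_trace (A * B) = mat_trace (B * A)"
proof -
  have "mat_trace (A * B) = (\<Sum>i<n. \<Sum>j<k. A $$ (i, j) * B $$ (j, i))"
    using assms by (auto simp: mat_trace_def scalar_prod_def atLeast0LessThan intro!: sum.cong)
  also have "\<dots> = (\<Sum>j<k. \<Sum>i<n. A $$ (i, j) * B $$ (j, i))"
    by (rule sum.swap)
  also have "\<dots> = mat_trace (B * A)"
    using assms by (auto simp: mat_trace_def scalar_prod_def atLeast0LessThan mult_ac intro!: sum.cong)
  finally show ?thesis .
qed

lemma mat_trace_add:
  assumes "A \<in> carrier_mat n n" "B \<in> carrier_mat n n"
  shows "mat_trace (A + B) = mat_trace A + mat_trace B"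
  using assms by (auto simp: mat_trace_def sum.distrib intro!: sum.cong)

lemma mat_trace_minus:
  assumes "A \<in> carrier_mat n n" "B \<in> carrier_mat n n"
  shows "mat_trace (A - B) = mat_trace A - mat_trace B"
  using assms by (auto simp: mat_trace_def sum_subtractf intro!: sum.cong)

lemma mat_trace_smult:
  assumes "A \<in> carrier_mat n n"
  shows "mat_trace (c \<cdot>\<^sub>m A) = c * mat_trace A"
  using assms by (auto simp: mat_trace_def sum_distrib_left intro!: sum.cong)

section \<open>Block diagonal matrices and vertically stacked matrices\<close>

definition block_diag :: "complex mat \<Rightarrow> complex mat \<Rightarrow> complex mat" where
  "block_diag A B =
    four_block_mat A (0\<^sub>m (dim_row A) (dim_col B)) (0\<^sub>m (dim_row B) (dim_col A)) B"

lemma block_diag_carrier: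
  "A \<in> carrier_mat n n \<Longrightarrow> B \<in> carrier_mat k k \<Longrightarrow> block_diag A B \<in> carrier_mat (n + k) (n + k)"
  by (simp add: block_diag_def)

lemma block_diag_mult:
  assumes "A \<in> carrier_mat n n" "B \<in> carrier_mat k k" "C \<in> carrier_mat n n" "D \<in> carrier_mat k k"
  shows "block_diag A B * block_diag C D = block_diag (A * C) (B * D)"
proof -
  have "block_diag A B * block_diag C D =
      four_block_mat A (0\<^sub>m n k) (0\<^sub>m k n) B * four_block_mat C (0\<^sub>m n k) (0\<^sub>m k n) D"
    using assms by (auto simp: block_diag_def)
  also have "\<dots> = block_diag (A * C) (B * D)"
    using assms by (subst mult_four_block_mat[of _ n n _ k _ k _ _ n _ k]) (auto simp: block_diag_def)
  finally show ?thesis .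
qed

lemma block_diag_adjoint:
  assumes "A \<in> carrier_mat n n" "B \<in> carrier_mat k k"
  shows "mat_adjoint (block_diag A B) = block_diag (mat_adjoint A) (mat_adjoint B)"
  using assms by (simp add: block_diag_def mat_adjoint_four_block[of _ n n _ k _ k])

lemma mat_trace_block_diag:
  assumes "A \<in> carrier_mat n n" "B \<in> carrier_mat k k"
  shows "mat_trace (block_diag A B) = mat_trace A + mat_trace B"
proof -
  have split: "{..<n + k} = {..<n} \<union> {n..<n + k}" by auto
  have "(\<Sum>i\<in>{n..<n + k}. block_diag A B $$ (i, i)) = (\<Sum>i<k. B $$ (i, i))"
    by (rule sum.reindex_bij_witness[of _ "\<lambda>i. i + n" "\<lambda>i. i - n"])
      (use assms in \<open>auto simp: block_diag_def\<close>)
  moreover have "(\<Sum>i<n. block_diag A B $$ (i, i)) = (\<Sum>i<n. A $$ (i, i))"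
    using assms by (auto simp: block_diag_def intro!: sum.cong)
  moreover have "mat_trace (block_diag A B) = (\<Sum>i\<in>{..<n} \<union> {n..<n + k}. block_diag A B $$ (i, i))"
    using assms by (simp only: mat_trace_def flip: split) (simp add: block_diag_def)
  moreover have "\<dots> = (\<Sum>i<n. block_diag A B $$ (i, i)) + (\<Sum>i\<in>{n..<n + k}. block_diag A B $$ (i, i))"
    by (rule sum.union_disjoint) auto
  ultimately show ?thesis
    using assms by (simp add: mat_trace_def)
qed

lemma block_diag_mult_append_rows:
  assumes "A \<in> carrier_mat n n" "B \<in> carrier_mat k k" "C \<in> carrier_mat n l" "D \<in> carrier_mat k l"
  shows "block_diag A B * (C @\<^sub>r D) = (A * C) @\<^sub>r (B * D)"
proof -
  have "block_diag A B * (C @\<^sub>r D) =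
      four_block_mat A (0\<^sub>m n k) (0\<^sub>m k n) B * four_block_mat C (0\<^sub>m n 0) D (0\<^sub>m k 0)"
    using assms by (auto simp: block_diag_def append_rows_def)
  also have "\<dots> = (A * C) @\<^sub>r (B * D)"
    using assms
    by (subst mult_four_block_mat[of _ n n _ k _ k _ _ l _ 0]) (auto simp: append_rows_def)
  finally show ?thesis .
qed

text \<open>Stacking with \<open>@\<^sub>r\<close> is a block matrix whose right column has width
  zero, and the adjoint turns this column into a lower row of height zero. The block product then
  has a single nonempty block.\<close>

lemma adjoint_append_rows_mult_append_rows:
  fixes A B C D :: "complex mat"
  assumes "A \<in> carrier_mat n l" "B \<in> carrier_mat k l" "C \<in> carrier_mat n l" "D \<in> carrier_mat k l"
  shows "mat_adjoint (A @\<^sub>r B) * (C @\<^sub>r D) = mat_adjoint A * C + mat_adjoint B * D"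
proof -
  have "mat_adjoint (A @\<^sub>r B) * (C @\<^sub>r D) =
      four_block_mat (mat_adjoint A) (mat_adjoint B) (0\<^sub>m 0 n) (0\<^sub>m 0 k) *
      four_block_mat C (0\<^sub>m n 0) D (0\<^sub>m k 0)"
    using assms by (simp add: append_rows_def mat_adjoint_four_block[of _ n l _ 0 _ k])
  also have "\<dots> = four_block_mat (mat_adjoint A * C + mat_adjoint B * D) (0\<^sub>m l 0) (0\<^sub>m 0 l) (0\<^sub>m 0 0)"
    using assms
    by (subst mult_four_block_mat[of _ l n _ k _ 0 _ _ l _ 0]) (auto simp: mat_adjoint_carrier)
  also have "\<dots> = mat_adjoint A * C + mat_adjoint B * D"
    by (rule eq_matI) (use assms in auto)
  finally show ?thesis .
qed

text \<open>In this order the column of width zero meets the row of height zero and contributes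
  nothing, so each block of the result is a single product.\<close>

lemma append_rows_mult_adjoint_append_rows:
  fixes A B C D :: "complex mat"
  assumes "A \<in> carrier_mat n l" "B \<in> carrier_mat k l" "C \<in> carrier_mat n l" "D \<in> carrier_mat k l"
  shows "(A @\<^sub>r B) * mat_adjoint (C @\<^sub>r D) =
    four_block_mat (A * mat_adjoint C) (A * mat_adjoint D) (B * mat_adjoint C) (B * mat_adjoint D)"
proof -
  have "(A @\<^sub>r B) * mat_adjoint (C @\<^sub>r D) =
      four_block_mat A (0\<^sub>m n 0) B (0\<^sub>m k 0) *
      four_block_mat (mat_adjoint C) (mat_adjoint D) (0\<^sub>m 0 n) (0\<^sub>m 0 k)"
    using assms by (simp add: append_rows_def mat_adjoint_four_block[of _ n l _ 0 _ k])
  also have "\<dots> = four_block_mat (A * mat_adjoint C) (A * mat_adjoint D) (B * mat_adjoint C) (B * mat_adjoint D)"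
    using assms
    by (subst mult_four_block_mat[of _ n l _ 0 _ k _ _ n _ k]) (auto simp: mat_adjoint_carrier)
  finally show ?thesis .
qed


section \<open>Spectral decomposition of Hermitian matrices\<close>

text \<open>This is the expression inside \<open>spec_fun\<close>, named so that a decomposition
  becomes a single term. The diagonal \<open>d\<close> is real, as for the eigenvalues of a
  Hermitian matrix.\<close>

definition unitary_conj_diag :: "nat \<Rightarrow> complex mat \<Rightarrow> (nat \<Rightarrow> real) \<Rightarrow> complex mat" where
  "unitary_conj_diag n U d = U * mat_diag n (\<lambda>i. complex_of_real (d i)) * mat_adjoint U"

lemma is_unitaryD:
  assumes "is_unitary n U"
  shows "U \<in> carrier_mat n n" "dim_row U = n" "dim_col U = n"
    "U * mat_adjoint U = 1\<^sub>m n" "mat_adjoint U * U = 1\<^sub>m n"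
  using assms by (auto simp: is_unitary_def)

lemma is_unitary_one: "is_unitary n (1\<^sub>m n)"
  by (simp add: is_unitary_def)

text \<open>In products bracketed to the right, adjacent factors \<open>U\<close> and
  \<open>mat_adjoint U\<close> are followed by the rest \<open>X\<close> of the product; this form
  cancels them there.\<close>

lemma unitary_cancel:
  assumes "is_unitary n U" "dim_row X = n"
  shows "mat_adjoint U * (U * X) = X" "U * (mat_adjoint U * X) = X"
proof -
  note U = is_unitaryD[OF assms(1)]
  show "mat_adjoint U * (U * X) = X" "U * (mat_adjoint U * X) = X"
    using U assms(2) by (simp_all flip: mult_mat_assoc_dim)
qed

lemma is_unitary_mult:
  assumes "is_unitary n U" "is_unitary n V"
  shows "is_unitary n (U * V)"
  using assms is_unitaryD[OF assms(1)] is_unitaryD[OF assms(2)]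
  by (auto simp: is_unitary_def mat_adjoint_mult mult_mat_assoc_dim unitary_cancel)

lemma is_unitary_block_diag:
  assumes "is_unitary n U" "is_unitary k V"
  shows "is_unitary (n + k) (block_diag U V)"
proof -
  note UV = is_unitaryD[OF assms(1)] is_unitaryD[OF assms(2)]
  then show ?thesis
    by (auto simp: is_unitary_def block_diag_adjoint[of _ n _ k] mat_adjoint_carrier
        block_diag_mult[of _ n _ k] block_diag_carrier)
      (auto simp: block_diag_def)
qed

lemma mat_diag_dims [simp]: "dim_row (mat_diag n f) = n" "dim_col (mat_diag n f) = n"
  by (auto simp: mat_diag_def)

lemma mat_adjoint_diag:
  "mat_adjoint (mat_diag n (\<lambda>i. complex_of_real (d i))) = mat_diag n (\<lambda>i. complex_of_real (d i))"
  by (rule eq_matI) (auto simp: mat_diag_def)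

lemma unitary_conj_diag_carrier:
  assumes "is_unitary n U"
  shows "unitary_conj_diag n U d \<in> carrier_mat n n"
  using is_unitaryD[OF assms] by (auto simp: unitary_conj_diag_def intro!: carrier_matI)

lemma unitary_conj_diag_adjoint:
  assumes "is_unitary n U"
  shows "mat_adjoint (unitary_conj_diag n U d) = unitary_conj_diag n U d"
  using is_unitaryD[OF assms]
  by (simp add: unitary_conj_diag_def mat_adjoint_mult mat_adjoint_diag mult_mat_assoc_dim)

lemma unitary_conj_diag_mult:
  assumes "is_unitary n U"
  shows "unitary_conj_diag n U d * unitary_conj_diag n U e = unitary_conj_diag n U (\<lambda>i. d i * e i)"
proof -
  note U = is_unitaryD[OF assms]
  have "unitary_conj_diag n U d * unitary_conj_diag n U e =
      U * (mat_diag n (\<lambda>i. complex_of_real (d i)) * (mat_diag n (\<lambda>i. complex_of_real (e i)) * mat_adjoint U))"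
    using U by (simp add: unitary_conj_diag_def mult_mat_assoc_dim unitary_cancel[OF assms])
  also have "\<dots> = unitary_conj_diag n U (\<lambda>i. d i * e i)"
    using U by (simp add: unitary_conj_diag_def mult_mat_assoc_dim flip: mat_diag_diag)
  finally show ?thesis .
qed

text \<open>The eigenvalue lists of the blocks are concatenated, the second one shifted by
  \<open>n\<close>. This serves both the induction step of the spectral theorem and the functional
  calculus of block diagonal matrices.\<close>

lemma unitary_conj_diag_block:
  assumes "is_unitary n U" "is_unitary k V"
  shows "block_diag (unitary_conj_diag n U d) (unitary_conj_diag k V e) =
    unitary_conj_diag (n + k) (block_diag U V) (\<lambda>i. if i < n then d i else e (i - n))"
proof -
  note UV = is_unitaryD[OF assms(1)] is_unitaryD[OF assms(2)]
  have D: "mat_diag (n + k) (\<lambda>i. complex_of_real (if i < n then d i else e (i - n))) =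
      block_diag (mat_diag n (\<lambda>i. complex_of_real (d i))) (mat_diag k (\<lambda>i. complex_of_real (e i)))"
    by (rule eq_matI) (auto simp: mat_diag_def block_diag_def)
  show ?thesis
    unfolding unitary_conj_diag_def D
    using UV by (simp add: block_diag_adjoint[of _ n _ k] mat_adjoint_carrier
        block_diag_mult[of _ n _ k])
qed

text \<open>A complex matrix of positive size has an eigenvector. Completing it to a basis,
  orthogonalising by Gram-Schmidt and normalising gives the columns of \<open>W\<close>, the first
  of which is a multiple of the eigenvector.\<close>

lemma exists_unitary_first_col_eigenvector:
  assumes A: "A \<in> carrier_mat n n" and n: "n > 0"
  obtains W e where "is_unitary n W" "\<And>i. i < n \<Longrightarrow> (A * W) $$ (i, 0) = e * W $$ (i, 0)"
proof -
  from spectrum_non_empty[OF A n] obtain e where "eigenvalue A e"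
    by (auto simp: spectrum_def)
  then obtain v where v: "v \<in> carrier_vec n" "v \<noteq> 0\<^sub>v n" "A *\<^sub>v v = e \<cdot>\<^sub>v v"
    using A by (auto simp: eigenvalue_def eigenvector_def)
  interpret cof_vec_space n "TYPE(complex)" .
  define b where "b = basis_completion v"
  define ws where "ws = gram_schmidt n b"
  from basis_completion[OF v(1,2), folded b_def]
  have dist_b: "distinct b" and indep: "\<not> lin_dep (set b)" and b: "set b \<subseteq> carrier_vec n"
    and hdb: "hd b = v" and len_b: "length b = n" by auto
  from hdb len_b n obtain vs where bv: "b = v # vs" by (cases b) auto
  from gram_schmidt_result[OF b dist_b indep refl, folded ws_def]
  have ws: "set ws \<subseteq> carrier_vec n" "corthogonal ws" "length ws = n"
    by (auto simp: len_b)
  \<comment> \<open>Gram-Schmidt leaves the first vector unchanged, so the eigenvector stays in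
    front.\<close>
  have hdws: "hd ws = v"
    using gram_schmidt_hd[OF v(1), of vs, folded bv] unfolding ws_def .
  have ws0: "ws ! 0 = v" using hdws ws(3) n by (cases ws) auto
  have wsc: "ws ! i \<in> carrier_vec n" if "i < n" for i using ws that by auto
  \<comment> \<open>\<open>c i\<close> is the squared norm of the \<open>i\<close>-th orthogonal
    vector; its square root normalises the columns of \<open>W\<close>.\<close>
  define c where "c i = (\<Sum>j<n. (cmod (ws ! i $ j))\<^sup>2)" for i
  have c: "ws ! i \<bullet>c ws ! i = complex_of_real (c i)" if "i < n" for i
    using wsc[OF that] by (simp only: cscalar_prod_self c_def carrier_vecD)
  have cpos: "c i > 0" if "i < n" for i
  proof -
    have "ws ! i \<bullet>c ws ! i \<noteq> 0" using corthogonalD[OF ws(2), of i i] that ws(3) by auto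
    then have "c i \<noteq> 0" using c[OF that] by auto
    moreover have "c i \<ge> 0" by (auto simp: c_def intro!: sum_nonneg)
    ultimately show ?thesis by simp
  qed
  define W where "W = mat n n (\<lambda>(i, j). ws ! j $ i / complex_of_real (sqrt (c j)))"
  have W: "W \<in> carrier_mat n n" by (simp add: W_def)
  have "mat_adjoint W * W = 1\<^sub>m n"
  proof (rule eq_matI)
    fix i j assume "i < dim_row (1\<^sub>m n)" "j < dim_col (1\<^sub>m n)"
    then have ij: "i < n" "j < n" by auto
    have "(mat_adjoint W * W) $$ (i, j) =
        (\<Sum>l<n. ws ! j $ l * cnj (ws ! i $ l) / (sqrt (c i) * sqrt (c j)))"
      using ij by (auto simp: W_def scalar_prod_def atLeast0LessThan mult_ac intro!: sum.cong)
    also have "\<dots> = (ws ! j \<bullet>c ws ! i) / (sqrt (c i) * sqrt (c j))"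
      using wsc[OF ij(1)] wsc[OF ij(2)]
      by (auto simp: scalar_prod_def atLeast0LessThan sum_divide_distrib intro!: sum.cong)
    also have "\<dots> = 1\<^sub>m n $$ (i, j)"
    proof (cases "i = j")
      case True
      then show ?thesis using ij c[of i] cpos[of i]
        by (simp flip: of_real_mult)
    next
      case False
      then show ?thesis using ij corthogonalD[OF ws(2), of j i] ws(3) by auto
    qed
    finally show "(mat_adjoint W * W) $$ (i, j) = 1\<^sub>m n $$ (i, j)" .
  qed (use W in auto)
  \<comment> \<open>For square matrices a left inverse is also a right inverse.\<close>
  then have "is_unitary n W"
    using mat_mult_left_right_inverse[OF mat_adjoint_carrier[OF W] W] W
    by (auto simp: is_unitary_def)
  moreover have "(A * W) $$ (i, 0) = e * W $$ (i, 0)" if "i < n" for i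
  proof -
    have "(A * W) $$ (i, 0) = (\<Sum>l<n. A $$ (i, l) * v $ l) / sqrt (c 0)"
      using that n A
      by (auto simp: W_def scalar_prod_def atLeast0LessThan ws0 sum_divide_distrib intro!: sum.cong)
    also have "(\<Sum>l<n. A $$ (i, l) * v $ l) = (A *\<^sub>v v) $ i"
      using that A v(1) by (auto simp: scalar_prod_def atLeast0LessThan intro!: sum.cong)
    also have "\<dots> = e * v $ i" using v that by simp
    finally show ?thesis using that n by (simp add: W_def ws0)
  qed
  ultimately show ?thesis using that by blast
qed

text \<open>Induction on the size: in an orthonormal basis that starts with an eigenvector, the
  first column vanishes below the diagonal, and by symmetry the first row vanishes beside it. What
  remains is a Hermitian block of size one less.\<close>

theorem hermitian_spectral_decomposition:
  assumes "A \<in> carrier_mat n n" "mat_adjoint A = A"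
  shows "\<exists>U d. is_unitary n U \<and> A = unitary_conj_diag n U d"
  using assms
proof (induction n arbitrary: A)
  case 0
  then have "A = unitary_conj_diag 0 (1\<^sub>m 0) (\<lambda>_. 0)"
    by (intro eq_matI) (auto simp: unitary_conj_diag_def)
  then show ?case using is_unitary_one by blast
next
  case (Suc k)
  obtain W e where W: "is_unitary (Suc k) W"
    and e: "\<And>i. i < Suc k \<Longrightarrow> (A * W) $$ (i, 0) = e * W $$ (i, 0)"
    using exists_unitary_first_col_eigenvector[OF Suc.prems(1)] by blast
  note UW = is_unitaryD[OF W]
  define A' where "A' = mat_adjoint W * (A * W)"
  have A': "A' \<in> carrier_mat (Suc k) (Suc k)" using UW Suc.prems by (auto simp: A'_def intro!: carrier_matI)
  have herm: "mat_adjoint A' = A'"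
    using UW Suc.prems by (simp add: A'_def mat_adjoint_mult mult_mat_assoc_dim)
  have herm_index: "cnj (A' $$ (j, i)) = A' $$ (i, j)" if "i < Suc k" "j < Suc k" for i j
    using mat_adjoint_index[of i A' j] that A' herm by auto
  \<comment> \<open>The first column of \<open>A * W\<close> is \<open>e\<close> times that of
    \<open>W\<close>, which \<open>mat_adjoint W\<close> sends to the first unit vector.\<close>
  have col0: "A' $$ (i, 0) = (if i = 0 then e else 0)" if "i < Suc k" for i
  proof -
    have "A' $$ (i, 0) = (\<Sum>l<Suc k. mat_adjoint W $$ (i, l) * (A * W) $$ (l, 0))"
      using that UW Suc.prems
      by (auto simp: A'_def scalar_prod_def atLeast0LessThan simp del: sum.lessThan_Suc intro!: sum.cong)
    also have "\<dots> = e * (\<Sum>l<Suc k. mat_adjoint W $$ (i, l) * W $$ (l, 0))"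
      using e by (auto simp: sum_distrib_left mult_ac simp del: sum.lessThan_Suc intro!: sum.cong)
    also have "(\<Sum>l<Suc k. mat_adjoint W $$ (i, l) * W $$ (l, 0)) = (mat_adjoint W * W) $$ (i, 0)"
      using that UW(1-3)
      by (auto simp: scalar_prod_def atLeast0LessThan simp del: sum.lessThan_Suc intro!: sum.cong)
    also have "\<dots> = (if i = 0 then 1 else 0)" using UW that by simp
    finally show ?thesis by simp
  qed
  have row0: "A' $$ (0, j) = (if j = 0 then e else 0)" if "j < Suc k" for j
    using herm_index[of 0 j] col0[of j] col0[of 0] herm_index[of 0 0] that by auto
  \<comment> \<open>A diagonal entry of a Hermitian matrix is its own conjugate; hence the
    eigenvalue may enter the real diagonal of \<open>unitary_conj_diag\<close>.\<close>
  have e_real: "complex_of_real (Re e) = e"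
    using herm_index[of 0 0] col0[of 0] by (simp add: complex_eq_iff)
  define B where "B = mat k k (\<lambda>(i, j). A' $$ (Suc i, Suc j))"
  have "mat_adjoint B = B"
    by (rule eq_matI) (auto simp: B_def herm_index)
  then obtain V d where V: "is_unitary k V" "B = unitary_conj_diag k V d"
    using Suc.IH[of B] by (auto simp: B_def)
  have one: "unitary_conj_diag 1 (1\<^sub>m 1) (\<lambda>_. Re e) = mat 1 1 (\<lambda>_. e)"
    by (rule eq_matI) (auto simp: unitary_conj_diag_def mat_diag_def e_real scalar_prod_def)
  have "A' = block_diag (unitary_conj_diag 1 (1\<^sub>m 1) (\<lambda>_. Re e)) B"
    unfolding one
  proof (rule eq_matI)
    fix i j
    assume "i < dim_row (block_diag (mat 1 1 (\<lambda>_. e)) B)" "j < dim_col (block_diag (mat 1 1 (\<lambda>_. e)) B)"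
    then have "i < Suc k" "j < Suc k" by (auto simp: block_diag_def B_def)
    then show "A' $$ (i, j) = block_diag (mat 1 1 (\<lambda>_. e)) B $$ (i, j)"
      using col0 row0 by (cases i; cases j) (auto simp: block_diag_def B_def)
  qed (use A' in \<open>auto simp: block_diag_def B_def\<close>)
  also have "\<dots> = unitary_conj_diag (1 + k) (block_diag (1\<^sub>m 1) V) (\<lambda>i. if i < 1 then Re e else d (i - 1))"
    unfolding V(2) by (rule unitary_conj_diag_block[OF is_unitary_one V(1)])
  finally obtain Z d' where Z: "is_unitary (Suc k) Z" and A'Z: "A' = unitary_conj_diag (Suc k) Z d'"
    using is_unitary_block_diag[OF is_unitary_one V(1), of 1] by auto
  \<comment> \<open>Undoing the change of basis: if \<open>Z\<close> diagonalises \<open>A'\<close>,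
    then \<open>W * Z\<close> diagonalises \<open>A\<close>.\<close>
  have "A = W * (A' * mat_adjoint W)"
    using UW Suc.prems by (simp add: A'_def mult_mat_assoc_dim unitary_cancel[OF W])
  also have "\<dots> = unitary_conj_diag (Suc k) (W * Z) d'"
    using UW is_unitaryD[OF Z]
    by (simp add: A'Z unitary_conj_diag_def mult_mat_assoc_dim mat_adjoint_mult)
  finally show ?case using is_unitary_mult[OF W Z] by blast
qed


section \<open>Functional calculus\<close>

text \<open>In the two eigenbases \<open>X\<close> becomes a matrix \<open>M\<close>, and the
  hypothesis says that \<open>d i\<close> and \<open>e j\<close> agree after multiplication by the
  entry of \<open>M\<close> at \<open>(i, j)\<close>. So either this entry is zero or
  \<open>d i = e j\<close>, and both cases survive the application of \<open>f\<close>.\<close>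

lemma unitary_conj_diag_intertwine:
  assumes U: "is_unitary n U" and V: "is_unitary k V" and X: "X \<in> carrier_mat n k"
    and AX: "unitary_conj_diag n U d * X = X * unitary_conj_diag k V e"
  shows "unitary_conj_diag n U (\<lambda>i. f (d i)) * X = X * unitary_conj_diag k V (\<lambda>i. f (e i))"
proof -
  note dims = is_unitaryD[OF U] is_unitaryD[OF V]
  define M where "M = mat_adjoint U * (X * V)"
  have M: "M \<in> carrier_mat n k" using dims X by (auto simp: M_def intro!: carrier_matI)
  have XM: "X = U * (M * mat_adjoint V)"
    using dims X by (simp add: M_def mult_mat_assoc_dim unitary_cancel[OF U])
  have left: "unitary_conj_diag n U g * X = U * ((mat_diag n (\<lambda>i. complex_of_real (g i)) * M) * mat_adjoint V)"
    for g :: "nat \<Rightarrow> real"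
    using dims M by (simp add: XM unitary_conj_diag_def mult_mat_assoc_dim unitary_cancel[OF U])
  have right: "X * unitary_conj_diag k V g = U * ((M * mat_diag k (\<lambda>i. complex_of_real (g i))) * mat_adjoint V)"
    for g :: "nat \<Rightarrow> real"
    using dims M by (simp add: XM unitary_conj_diag_def mult_mat_assoc_dim unitary_cancel[OF V])
  \<comment> \<open>Conjugating back recovers the middle factor, so an equation between the forms in
    \<open>left\<close> and \<open>right\<close> passes to their middle factors.\<close>
  have strip: "mat_adjoint U * (U * (N * mat_adjoint V)) * V = N" if "N \<in> carrier_mat n k" for N
    using that dims by (simp add: mult_mat_assoc_dim unitary_cancel[OF U])
  have "mat_diag n (\<lambda>i. complex_of_real (d i)) * M = M * mat_diag k (\<lambda>i. complex_of_real (e i))"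
    using AX[unfolded left right] strip[of "mat_diag n (\<lambda>i. complex_of_real (d i)) * M"]
      strip[of "M * mat_diag k (\<lambda>i. complex_of_real (e i))"] M
    by (metis mult_carrier_mat mat_diag_dim)
  then have *: "complex_of_real (d i) * M $$ (i, j) = M $$ (i, j) * complex_of_real (e j)"
    if "i < n" "j < k" for i j
    using that unfolding mat_diag_mult_left[OF M] mat_diag_mult_right[OF M]
    by (auto dest: arg_cong[of _ _ "\<lambda>N. N $$ (i, j)"])
  have "mat_diag n (\<lambda>i. complex_of_real (f (d i))) * M = M * mat_diag k (\<lambda>i. complex_of_real (f (e i)))"
    unfolding mat_diag_mult_left[OF M] mat_diag_mult_right[OF M]
  proof (rule eq_matI, goal_cases)
    case (1 i j)
    then show ?case using *[of i j] by (cases "M $$ (i, j) = 0") auto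
  qed auto
  then show ?thesis by (simp only: left right)
qed

text \<open>The definite description needs uniqueness: two diagonalisations of one matrix are
  intertwined by the identity, so applying \<open>f\<close> to the eigenvalues gives the same result
  for both.\<close>

lemma spec_fun_unitary_conj_diag:
  assumes U: "is_unitary n U"
  shows "spec_fun f (unitary_conj_diag n U d) = unitary_conj_diag n U (\<lambda>i. f (d i))"
proof -
  define A where "A = unitary_conj_diag n U d"
  have n: "dim_row A = n" using unitary_conj_diag_carrier[OF U, of d] by (simp add: A_def)
  have unique: "unitary_conj_diag n V (\<lambda>i. f (e i)) = unitary_conj_diag n U (\<lambda>i. f (d i))"
    if V: "is_unitary n V" and AV: "A = unitary_conj_diag n V e" for V e
  proof -
    have "unitary_conj_diag n V e * 1\<^sub>m n = 1\<^sub>m n * unitary_conj_diag n U d"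
      unfolding right_mult_one_mat[OF unitary_conj_diag_carrier[OF V]]
        left_mult_one_mat[OF unitary_conj_diag_carrier[OF U]] using AV by (simp add: A_def)
    from unitary_conj_diag_intertwine[OF V U one_carrier_mat this, of f] show ?thesis
      using right_mult_one_mat[OF unitary_conj_diag_carrier[OF V]]
        left_mult_one_mat[OF unitary_conj_diag_carrier[OF U]] by simp
  qed
  show ?thesis
    unfolding A_def[symmetric] spec_fun_def n unitary_conj_diag_def[symmetric]
  proof (rule the_equality)
    show "\<exists>V e. is_unitary n V \<and> A = unitary_conj_diag n V e \<and>
        unitary_conj_diag n U (\<lambda>i. f (d i)) = unitary_conj_diag n V (\<lambda>i. f (e i))"
      using U A_def by blast
  qed (use unique in blast)
qed

text \<open>The \<open>i\<close>-th column of \<open>U\<close> is a unit eigenvector for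
  \<open>d i\<close>, so \<open>d i\<close> is the value of the quadratic form of \<open>A\<close>
  at this column.\<close>

lemma psd_spectral_decomposition:
  assumes "is_psd n A"
  obtains U d where "is_unitary n U" "A = unitary_conj_diag n U d" "\<And>i. i < n \<Longrightarrow> d i \<ge> 0"
proof -
  from assms have A: "A \<in> carrier_mat n n" "mat_adjoint A = A"
    and psd: "\<And>v. v \<in> carrier_vec n \<Longrightarrow> 0 \<le> Re ((A *\<^sub>v v) \<bullet>c v)"
    by (auto simp: is_psd_def)
  from hermitian_spectral_decomposition[OF A] obtain U d
    where U: "is_unitary n U" and AU: "A = unitary_conj_diag n U d" by blast
  note dims = is_unitaryD[OF U]
  have "d i \<ge> 0" if i: "i < n" for i
  proof -
    have "A * U = U * mat_diag n (\<lambda>i. complex_of_real (d i))"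
      using dims by (simp add: AU unitary_conj_diag_def mult_mat_assoc_dim)
    then have "A *\<^sub>v col U i = col (U * mat_diag n (\<lambda>i. complex_of_real (d i))) i"
      using col_mult2[OF A(1) dims(1) i] by simp
    also have "\<dots> = complex_of_real (d i) \<cdot>\<^sub>v col U i"
      unfolding mat_diag_mult_right[OF dims(1)] by (rule eq_vecI) (use dims i in auto)
    finally have "A *\<^sub>v col U i = complex_of_real (d i) \<cdot>\<^sub>v col U i" .
    moreover have "col U i \<bullet>c col U i = (mat_adjoint U * U) $$ (i, i)"
      using dims(1-3) i by (auto simp: scalar_prod_def mult_ac intro!: sum.cong)
    ultimately have "(A *\<^sub>v col U i) \<bullet>c col U i = complex_of_real (d i)"
      using dims i by (simp add: col_carrier_vec)
    then show ?thesis using psd[of "col U i"] dims i by (simp add: col_carrier_vec)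
  qed
  then show ?thesis using that U AU by blast
qed

lemma spec_fun_hermitian:
  assumes "A \<in> carrier_mat n n" "mat_adjoint A = A"
  shows "spec_fun f A \<in> carrier_mat n n" "mat_adjoint (spec_fun f A) = spec_fun f A"
  using hermitian_spectral_decomposition[OF assms]
  by (auto simp: spec_fun_unitary_conj_diag unitary_conj_diag_carrier unitary_conj_diag_adjoint)

lemma spec_fun_id:
  assumes "A \<in> carrier_mat n n" "mat_adjoint A = A"
  shows "spec_fun (\<lambda>x. x) A = A"
  using hermitian_spectral_decomposition[OF assms]
  by (auto simp: spec_fun_unitary_conj_diag)

lemma spec_fun_mult:
  assumes "A \<in> carrier_mat n n" "mat_adjoint A = A"
  shows "spec_fun f A * spec_fun g A = spec_fun (\<lambda>x. f x * g x) A"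
  using hermitian_spectral_decomposition[OF assms]
  by (auto simp: spec_fun_unitary_conj_diag unitary_conj_diag_mult)

text \<open>All eigenvalues are nonnegative. In this way scalar identities valid for x \<ge> 0, such
  as \<open>sqrt x * sqrt x = x\<close>, become matrix identities.\<close>

lemma spec_fun_cong_psd:
  assumes "is_psd n A" "\<And>x. x \<ge> 0 \<Longrightarrow> f x = g x"
  shows "spec_fun f A = spec_fun g A"
proof -
  obtain U d where U: "is_unitary n U" "A = unitary_conj_diag n U d" "\<And>i. i < n \<Longrightarrow> d i \<ge> 0"
    using psd_spectral_decomposition[OF assms(1)] by blast
  have "mat_diag n (\<lambda>i. complex_of_real (f (d i))) = mat_diag n (\<lambda>i. complex_of_real (g (d i)))"
    by (rule eq_matI) (auto simp: mat_diag_def assms(2) U(3))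
  then show ?thesis
    by (simp only: U(2) spec_fun_unitary_conj_diag[OF U(1)]) (simp add: unitary_conj_diag_def)
qed

lemma spec_fun_block_diag:
  assumes "A \<in> carrier_mat n n" "mat_adjoint A = A" "B \<in> carrier_mat k k" "mat_adjoint B = B"
  shows "spec_fun f (block_diag A B) = block_diag (spec_fun f A) (spec_fun f B)"
proof -
  obtain U d V e where U: "is_unitary n U" "A = unitary_conj_diag n U d"
    and V: "is_unitary k V" "B = unitary_conj_diag k V e"
    using hermitian_spectral_decomposition[OF assms(1,2)] hermitian_spectral_decomposition[OF assms(3,4)]
    by blast
  have "(\<lambda>i. f (if i < n then d i else e (i - n))) = (\<lambda>i. if i < n then f (d i) else f (e (i - n)))"
    by auto
  then show ?thesis
    by (simp only: U(2) V(2) unitary_conj_diag_block[OF U(1) V(1)] spec_fun_unitary_conj_diag[OF U(1)]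
        spec_fun_unitary_conj_diag[OF V(1)]
        spec_fun_unitary_conj_diag[OF is_unitary_block_diag[OF U(1) V(1)]])
qed

lemma spec_fun_intertwine:
  assumes "A \<in> carrier_mat n n" "mat_adjoint A = A" "B \<in> carrier_mat k k" "mat_adjoint B = B"
    and "X \<in> carrier_mat n k" "A * X = X * B"
  shows "spec_fun f A * X = X * spec_fun f B"
proof -
  obtain U d V e where U: "is_unitary n U" "A = unitary_conj_diag n U d"
    and V: "is_unitary k V" "B = unitary_conj_diag k V e"
    using hermitian_spectral_decomposition[OF assms(1,2)] hermitian_spectral_decomposition[OF assms(3,4)]
    by blast
  show ?thesis
    using unitary_conj_diag_intertwine[OF U(1) V(1) assms(5), of d e f] assms(6)
    by (simp add: U V spec_fun_unitary_conj_diag)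
qed

text \<open>Each product reduces to a scalar identity on the eigenvalues. The last one holds at the
  eigenvalue 0 too, where all factors are 0, so it covers singular matrices; it removes the inverse
  square root from the bit error.\<close>

lemma mat_sqrt_psd:
  assumes "is_psd n A"
  shows "mat_sqrt A \<in> carrier_mat n n" "mat_adjoint (mat_sqrt A) = mat_sqrt A"
    "mat_sqrt A * mat_sqrt A = A"
    "mat_sqrt A * (mat_inv_sqrt A * mat_sqrt A) = mat_sqrt A"
proof -
  have A: "A \<in> carrier_mat n n" "mat_adjoint A = A" using assms by (auto simp: is_psd_def)
  show "mat_sqrt A \<in> carrier_mat n n" "mat_adjoint (mat_sqrt A) = mat_sqrt A"
    unfolding mat_sqrt_def using spec_fun_hermitian[OF A] by auto
  have "mat_sqrt A * mat_sqrt A = spec_fun (\<lambda>x. x) A"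
    unfolding mat_sqrt_def spec_fun_mult[OF A] by (rule spec_fun_cong_psd[OF assms]) auto
  then show "mat_sqrt A * mat_sqrt A = A" by (simp add: spec_fun_id[OF A])
  show "mat_sqrt A * (mat_inv_sqrt A * mat_sqrt A) = mat_sqrt A"
    unfolding mat_sqrt_def mat_inv_sqrt_def spec_fun_mult[OF A]
    by (rule spec_fun_cong_psd[OF assms]) auto
qed


section \<open>States and entropies\<close>

lemma mult_adjoint_hermitian:
  fixes Y :: "complex mat"
  assumes "Y \<in> carrier_mat n k"
  shows "Y * mat_adjoint Y \<in> carrier_mat n n" "mat_adjoint (Y * mat_adjoint Y) = Y * mat_adjoint Y"
  using assms by (auto simp: mat_adjoint_mult intro!: carrier_matI)

text \<open>The quadratic form at \<open>v\<close> is the squared norm of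
  \<open>mat_adjoint Y *\<^sub>v v\<close>.\<close>

lemma is_psd_mult_adjoint:
  assumes Y: "Y \<in> carrier_mat n k"
  shows "is_psd n (Y * mat_adjoint Y)"
  unfolding is_psd_def
proof (intro conjI ballI mult_adjoint_hermitian[OF Y])
  fix v :: "complex vec" assume v: "v \<in> carrier_vec n"
  define w where "w = mat_adjoint Y *\<^sub>v v"
  have w: "w \<in> carrier_vec k" using Y v by (auto simp: w_def intro!: carrier_vecI)
  have "(Y * mat_adjoint Y) *\<^sub>v v = Y *\<^sub>v w"
    unfolding w_def using assoc_mult_mat_vec[OF Y mat_adjoint_carrier[OF Y] v] .
  then have "((Y * mat_adjoint Y) *\<^sub>v v) \<bullet>c v = w \<bullet>c w"
    using cscalar_prod_adjoint[OF Y w v] by (simp add: w_def)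
  then show "0 \<le> Re (((Y * mat_adjoint Y) *\<^sub>v v) \<bullet>c v)"
    by (simp only: cscalar_prod_self Re_complex_of_real) (auto intro!: sum_nonneg)
qed

text \<open>With \<open>x log x = x g x\<close>, intertwining gives
  \<open>tr (g (Y Y*) Y Y*) = tr (Y g (Y* Y) Y*) = tr (Y* Y g (Y* Y))\<close>, so the spectra of \<open>Y Y*\<close> and
  \<open>Y* Y\<close> need not be compared.\<close>

lemma entropy_mult_adjoint_commute:
  assumes Y: "Y \<in> carrier_mat n k"
  shows "entropy (Y * mat_adjoint Y) = entropy (mat_adjoint Y * Y)"
proof -
  define g :: "real \<Rightarrow> real" where "g x = (if x = 0 then 0 else log 2 x)" for x
  define A where "A = Y * mat_adjoint Y"
  define B where "B = mat_adjoint Y * Y"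
  have Ya: "mat_adjoint Y \<in> carrier_mat k n" using Y by (rule mat_adjoint_carrier)
  have A: "A \<in> carrier_mat n n" "mat_adjoint A = A"
    unfolding A_def using mult_adjoint_hermitian[OF Y] by auto
  have B: "B \<in> carrier_mat k k" "mat_adjoint B = B"
    unfolding B_def using mult_adjoint_hermitian[OF Ya] by auto
  have h: "(\<lambda>x. if x = 0 then 0 else x * log 2 x) = (\<lambda>x. x * g x)"
    by (auto simp: g_def)
  have ent: "entropy C = - mat_trace (C * spec_fun g C)"
    if "C \<in> carrier_mat l l" "mat_adjoint C = C" for C l
    unfolding entropy_def h spec_fun_mult[OF that, of "\<lambda>x. x" g, symmetric] spec_fun_id[OF that] ..
  note gA = spec_fun_hermitian(1)[OF A, of g] and gB = spec_fun_hermitian(1)[OF B, of g]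
  \<comment> \<open>Both sides are Y Y* Y, bracketed differently.\<close>
  have "A * Y = Y * B" using Y by (simp add: A_def B_def mult_mat_assoc_dim)
  then have tw: "spec_fun g A * Y = Y * spec_fun g B" by (rule spec_fun_intertwine[OF A B Y])
  have "mat_trace (A * spec_fun g A) = mat_trace (spec_fun g A * A)"
    by (rule mat_trace_mult_commute[OF A(1) gA])
  also have "spec_fun g A * A = (Y * spec_fun g B) * mat_adjoint Y"
    using Y gA by (simp add: A_def mult_mat_assoc_dim flip: tw)
  also have "mat_trace \<dots> = mat_trace (mat_adjoint Y * (Y * spec_fun g B))"
    by (rule mat_trace_mult_commute[OF mult_carrier_mat[OF Y gB] Ya])
  also have "mat_adjoint Y * (Y * spec_fun g B) = B * spec_fun g B"
    using Y gB by (simp add: B_def mult_mat_assoc_dim)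
  finally show ?thesis by (simp add: ent[OF A] ent[OF B] flip: A_def B_def)
qed

lemma entropy_block_diag:
  assumes "A \<in> carrier_mat n n" "mat_adjoint A = A" "B \<in> carrier_mat k k" "mat_adjoint B = B"
  shows "entropy (block_diag A B) = entropy A + entropy B"
  unfolding entropy_def spec_fun_block_diag[OF assms]
  by (simp add: mat_trace_block_diag[OF spec_fun_hermitian(1)[OF assms(1,2)] spec_fun_hermitian(1)[OF assms(3,4)]])

theorem proposition8p1:
  fixes m :: nat and K L Y J \<sigma>0 \<sigma>1 :: "complex mat"
  assumes "m \<ge> 1"
    and "is_psd m K" and "is_psd m L"
    and "mat_trace (K + L) = 1"
    and "Y = mat_sqrt K @\<^sub>r mat_sqrt L"
    and "\<sigma>0 = Y * mat_adjoint Y"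
    and "J = four_block_mat (1\<^sub>m m) (0\<^sub>m m m) (0\<^sub>m m m) (- 1\<^sub>m m)"
    and "\<sigma>1 = J * \<sigma>0 * J"
  shows "cq_channel (2 * m) \<sigma>0 \<sigma>1 \<and> output_symmetric (2 * m) \<sigma>0 \<sigma>1
    \<and> holevo \<sigma>0 \<sigma>1 = entropy K + entropy L - entropy (K + L)
    \<and> pgm_bit_error \<sigma>0 \<sigma>1 = (1 - 2 * mat_trace (mat_sqrt K * mat_sqrt L)) / 2"
proof -

  \<comment> \<open>The channel and its output symmetry\<close>
  define P Q where "P = mat_sqrt K" and "Q = mat_sqrt L"
  have K: "K \<in> carrier_mat m m" "mat_adjoint K = K" and L: "L \<in> carrier_mat m m" "mat_adjoint L = L"
    using assms(2,3) by (auto simp: is_psd_def)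
  note P = mat_sqrt_psd[OF assms(2), folded P_def] and Q = mat_sqrt_psd[OF assms(3), folded Q_def]
  have Y: "Y = P @\<^sub>r Q" by (simp add: assms(5) P_def Q_def)
  have Yc: "Y \<in> carrier_mat (2 * m) m"
    using carrier_append_rows[OF P(1) Q(1)] by (simp add: Y mult_2)
  \<comment> \<open>\<open>Z\<close> will be \<open>J * Y\<close>. It gives \<open>\<sigma>1\<close>
    the same form as \<open>\<sigma>0\<close>, so whatever holds for a product Y Y* applies to both
    states.\<close>
  define Z where "Z = P @\<^sub>r - Q"
  have Zc: "Z \<in> carrier_mat (2 * m) m"
    using carrier_append_rows[OF P(1), of "- Q" m] Q(1) by (simp add: Z_def mult_2)
  have J: "J = block_diag (1\<^sub>m m) (- 1\<^sub>m m)" by (simp add: assms(7) block_diag_def)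
  have Jc: "J \<in> carrier_mat (2 * m) (2 * m)"
    unfolding J mult_2 by (rule block_diag_carrier) auto
  have Ja: "mat_adjoint J = J"
    unfolding J by (subst block_diag_adjoint[of _ m _ m]) (auto simp: mat_adjoint_uminus)
  have JJ: "J * J = 1\<^sub>m (2 * m)"
  proof -
    have "J * J = block_diag (1\<^sub>m m) (1\<^sub>m m)"
      unfolding J by (subst block_diag_mult[of _ m _ m]) auto
    then show ?thesis by (simp add: block_diag_def mult_2)
  qed
  have JU: "is_unitary (2 * m) J" using Jc Ja JJ by (simp add: is_unitary_def)
  have JY: "J * Y = Z"
    unfolding J Y Z_def using P(1) Q(1) by (subst block_diag_mult_append_rows[of _ m _ m _ m]) auto
  have \<sigma>1: "\<sigma>1 = Z * mat_adjoint Z"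
    unfolding assms(8) assms(6) JY[symmetric]
    using Jc Yc Ja by (simp add: mat_adjoint_mult mult_mat_assoc_dim)
  have YY: "mat_adjoint Y * Y = K + L"
    unfolding Y using adjoint_append_rows_mult_append_rows[OF P(1) Q(1) P(1) Q(1)]
    by (simp add: P(2,3) Q(2,3))
  have mQ: "- Q \<in> carrier_mat m m" using Q(1) by simp
  have mQmQ: "- Q * - Q = L" using Q(1,3) by simp
  \<comment> \<open>The sign of the lower block disappears on squaring, so \<open>Y\<close> and
    \<open>Z\<close> have the same Gram matrix.\<close>
  have ZZ: "mat_adjoint Z * Z = K + L"
    unfolding Z_def using adjoint_append_rows_mult_append_rows[OF P(1) mQ P(1) mQ]
    by (simp add: P(2,3) mat_adjoint_uminus Q(2) mQmQ)
  \<comment> \<open>By cyclicity both traces equal the trace of the common Gram matrix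
    \<open>K + L\<close>.\<close>
  have tr: "mat_trace \<sigma>0 = 1" "mat_trace \<sigma>1 = 1"
    unfolding assms(6) \<sigma>1
    using mat_trace_mult_commute[OF Yc mat_adjoint_carrier[OF Yc]]
      mat_trace_mult_commute[OF Zc mat_adjoint_carrier[OF Zc]] YY ZZ assms(4) by auto
  have channel: "cq_channel (2 * m) \<sigma>0 \<sigma>1"
    using tr is_psd_mult_adjoint[OF Yc] is_psd_mult_adjoint[OF Zc]
    by (simp add: cq_channel_def is_density_def assms(6) \<sigma>1)
  have \<sigma>0c: "\<sigma>0 \<in> carrier_mat (2 * m) (2 * m)"
    unfolding assms(6) by (rule mult_adjoint_hermitian[OF Yc])
  have "J * \<sigma>1 * J = \<sigma>0"
    using Jc \<sigma>0c Ja unitary_cancel[OF JU] JJ by (simp add: assms(8) mult_mat_assoc_dim)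
  \<comment> \<open>The witness is \<open>J\<close>: a self-adjoint involution is unitary and
    exchanges the two states in both directions.\<close>
  then have symmetric: "output_symmetric (2 * m) \<sigma>0 \<sigma>1"
    unfolding output_symmetric_def using JU Ja assms(8) by metis

  \<comment> \<open>The average state and the Holevo information\<close>
  have PQc: "P * Q \<in> carrier_mat m m" "Q * P \<in> carrier_mat m m" using P(1) Q(1) by auto
  \<comment> \<open>The off-diagonal blocks of the two states are opposite and cancel, while the
    diagonal blocks agree.\<close>
  have avg: "avg_state \<sigma>0 \<sigma>1 = block_diag K L"
  proof -
    have 0: "\<sigma>0 = four_block_mat K (P * Q) (Q * P) L"
      unfolding assms(6) Y
      using append_rows_mult_adjoint_append_rows[OF P(1) Q(1) P(1) Q(1)] by (simp add: P(2,3) Q(2,3))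
    have 1: "\<sigma>1 = four_block_mat K (- (P * Q)) (- (Q * P)) L"
      unfolding \<sigma>1 Z_def
      using append_rows_mult_adjoint_append_rows[OF P(1) mQ P(1) mQ] P(1) Q(1)
      by (simp add: P(2,3) Q(2,3) mat_adjoint_uminus mQmQ)
    show ?thesis
      unfolding avg_state_def 0 1 block_diag_def
      by (rule eq_matI) (use K L PQc P(1) Q(1) in auto)
  qed
  \<comment> \<open>Both states have the entropy of \<open>K + L\<close>, so the two halves add up
    to one full term.\<close>
  have holevo: "holevo \<sigma>0 \<sigma>1 = entropy K + entropy L - entropy (K + L)"
    unfolding holevo_def avg entropy_block_diag[OF K L]
    by (simp add: assms(6) \<sigma>1 entropy_mult_adjoint_commute[OF Yc] entropy_mult_adjoint_commute[OF Zc] YY ZZ)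

  \<comment> \<open>The error of the pretty good measurement\<close>
  define R where "R = block_diag (mat_inv_sqrt K) (mat_inv_sqrt L)"
  have R: "mat_inv_sqrt (avg_state \<sigma>0 \<sigma>1) = R"
    unfolding avg R_def mat_inv_sqrt_def by (rule spec_fun_block_diag[OF K L])
  have Ic: "mat_inv_sqrt K \<in> carrier_mat m m" "mat_inv_sqrt L \<in> carrier_mat m m"
    unfolding mat_inv_sqrt_def using spec_fun_hermitian(1)[OF K] spec_fun_hermitian(1)[OF L] by auto
  have Rc: "R \<in> carrier_mat (2 * m) (2 * m)"
    unfolding R_def mult_2 by (rule block_diag_carrier[OF Ic])
  \<comment> \<open>Blockwise, the inverse square root between two copies of the square root leaves
    one copy; the minus sign comes from the lower block of \<open>Z\<close>.\<close>
  have YRZ: "mat_adjoint Y * (R * Z) = P - Q"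
  proof -
    have "R * Z = (mat_inv_sqrt K * P) @\<^sub>r (- (mat_inv_sqrt L * Q))"
      unfolding R_def Z_def using block_diag_mult_append_rows[OF Ic P(1) mQ] Ic Q(1) by simp
    then show ?thesis
      unfolding Y
      using adjoint_append_rows_mult_append_rows[OF P(1) Q(1), of "mat_inv_sqrt K * P" "- (mat_inv_sqrt L * Q)"]
        Ic P Q minus_add_uminus_mat[OF P(1) Q(1)] by simp
  qed
  have ZRY: "mat_adjoint Z * (R * Y) = P - Q"
  proof -
    have "R * Y = (mat_inv_sqrt K * P) @\<^sub>r (mat_inv_sqrt L * Q)"
      unfolding R_def Y by (rule block_diag_mult_append_rows[OF Ic P(1) Q(1)])
    then show ?thesis
      unfolding Z_def
      using adjoint_append_rows_mult_append_rows[OF P(1) mQ, of "mat_inv_sqrt K * P" "mat_inv_sqrt L * Q"]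
        Ic P Q minus_add_uminus_mat[OF P(1) Q(1)] by (simp add: mat_adjoint_uminus)
  qed
  \<comment> \<open>\<open>P\<close> and \<open>Q\<close> need not commute, so the two cross terms
    are kept apart and identified only under the trace.\<close>
  have trP: "mat_trace ((P - Q) * (P - Q)) = 1 - 2 * mat_trace (P * Q)"
  proof -
    have PQ: "P - Q \<in> carrier_mat m m" using P(1) Q(1) by auto
    have "(P - Q) * (P - Q) = (K - Q * P) - (P * Q - L)"
      using P(1) Q(1) PQ
      by (simp add: mult_minus_distrib_mat[OF PQ P(1) Q(1)] minus_mult_distrib_mat[OF P(1) Q(1)] P(3) Q(3))
    moreover have "mat_trace (Q * P) = mat_trace (P * Q)" by (rule mat_trace_mult_commute[OF Q(1) P(1)])
    moreover have "K - Q * P \<in> carrier_mat m m" "P * Q - L \<in> carrier_mat m m"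
      using L(1) PQc(2) by (simp_all only: minus_carrier_mat)
    ultimately show ?thesis
      using assms(4) K L PQc by (simp add: mat_trace_minus[of _ m] mat_trace_add[of _ m])
  qed
  have "pgm_bit_error \<sigma>0 \<sigma>1 = mat_trace (\<sigma>0 * ((1 / 2) \<cdot>\<^sub>m (R * \<sigma>1 * R)))"
    by (simp add: pgm_bit_error_def pgm_elem_def R)
  also have "\<sigma>0 * ((1 / 2) \<cdot>\<^sub>m (R * \<sigma>1 * R)) =
      (1 / 2) \<cdot>\<^sub>m (Y * (mat_adjoint Y * (R * Z) * (mat_adjoint Z * R)))"
  proof -
    have "R * \<sigma>1 * R \<in> carrier_mat (2 * m) (2 * m)" using Rc Zc by (auto simp: \<sigma>1 intro!: carrier_matI)
    then have "\<sigma>0 * ((1 / 2) \<cdot>\<^sub>m (R * \<sigma>1 * R)) = (1 / 2) \<cdot>\<^sub>m (\<sigma>0 * (R * \<sigma>1 * R))"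
      by (rule mult_smult_distrib[OF \<sigma>0c])
    also have "\<sigma>0 * (R * \<sigma>1 * R) = Y * (mat_adjoint Y * (R * Z) * (mat_adjoint Z * R))"
      using Yc Zc Rc by (simp add: assms(6) \<sigma>1 mult_mat_assoc_dim)
    finally show ?thesis .
  qed
  also have "mat_trace \<dots> = (1 / 2) * mat_trace (Y * (mat_adjoint Y * (R * Z) * (mat_adjoint Z * R)))"
    by (rule mat_trace_smult[of _ "2 * m"]) (use Yc Zc Rc in \<open>auto intro!: carrier_matI\<close>)
  \<comment> \<open>Cyclicity moves \<open>Y\<close> to the end, where the product splits into the
    two factors computed in \<open>YRZ\<close> and \<open>ZRY\<close>, both equal to
    \<open>P - Q\<close>.\<close>
  also have "mat_trace (Y * (mat_adjoint Y * (R * Z) * (mat_adjoint Z * R))) =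
      mat_trace (mat_adjoint Y * (R * Z) * (mat_adjoint Z * R) * Y)"
    by (rule mat_trace_mult_commute[of _ "2 * m" m]) (use Yc Zc Rc in \<open>auto intro!: carrier_matI\<close>)
  also have "mat_adjoint Y * (R * Z) * (mat_adjoint Z * R) * Y =
      (mat_adjoint Y * (R * Z)) * (mat_adjoint Z * (R * Y))"
    using Yc Zc Rc by (simp add: mult_mat_assoc_dim)
  finally have "pgm_bit_error \<sigma>0 \<sigma>1 = (1 - 2 * mat_trace (mat_sqrt K * mat_sqrt L)) / 2"
    unfolding YRZ ZRY trP by (simp add: P_def Q_def)
  with channel symmetric holevo show ?thesis by blast
qed

end
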